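(* Consider static caching with an infinite buffer and a single content class, with content arrival rate $\lambda$, average file size $B$ bits, request-delay distribution function $P$ and non-request probability $q=P(0)$. The storage cost is an increasing function of the effective throughput $R$, given by $$S(R)=\lambda B\left[\int_{0}^{P^{-1}\left(\frac{R}{\lambda B}+q\right)} x\,dP(x)+\left(1-\frac{R}{\lambda B}\right)P^{-1}\left(\frac{R}{\lambda B}+q\right)\right],$$ where $P^{-1}(z)=\inf\{x : P(x)\ge z\}$, which is the inverse function of $P$ when $P$ is continuous.
   Context: Content files of average size $B$ bits arrive at a user with an infinite buffer at rate $\lambda$. The user requests a given file after a random delay $X$; $X=-\infty$ means that the file is never requested. The probability density function of $X$ is $p$ (possibly containing delta atoms), its cumulative distribution function is $P(x)=\int_{-\infty}^{x}p(z)\,dz$, and $q=P(0)$ is the probability that the file is never requested. Static caching with maximum caching time $t$: every file is cached on arrival and is removed when it is requested or when it has been cached for time $t$, whichever comes first. The effective throughput is the average number of bits the user reads from its buffer per unit time, $$R(t)=\lambda B\int_0^t p(x)\,dx=\lambda B\,(P(t)-q).$$ The storage cost is the average number of bits cached in the buffer, which by Little's law is $$S(t)=\lambda B\left[\int_0^t x\,p(x)\,dx+t\left(q+\int_t^\infty p(x)\,dx\right)\right].$$ $S(R)$ denotes the storage cost expressed through the effective throughput, with $t=P^{-1}\left(\frac{R}{\lambda B}+q\right)$; the normalized throughput $R/(\lambda B)$ (the hit ratio) ranges over $(0,1-q]$.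
   Formalization: If P jumps, the formula for S(R) and strict increase are claimed only for R attained by some caching time (they fail inside jumps; S is nondecreasing there); for continuous P, P(P^{-1}(z))=z, and P^{-1} is a two-sided inverse only if P has no flat stretch where q<P<1. *)

theory Defs
  imports "HOL-Probability.Probability"
begin

text \<open>
  The request delay is an extended-real random variable \<open>X\<close> on \<open>M\<close>, with \<open>X = -\<infinity>\<close> for a file that
  is never requested. A density that may contain delta atoms, and possibly an atom at \<open>-\<infinity>\<close>, is
  represented by the law of \<open>X\<close>: an integral against \<open>p(x) dx\<close> from \<open>0\<close> to \<open>t\<close> is an integral over
  \<open>{0<..t}\<close> against this law, so an atom at \<open>t\<close> is counted, as it is in \<open>P(t) - q\<close>.
\<close>

definition delay_law :: "'a measure \<Rightarrow> ('a \<Rightarrow> ereal) \<Rightarrow> ereal measure" where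
  "delay_law M X = distr M borel X"

definition delay_cdf :: "'a measure \<Rightarrow> ('a \<Rightarrow> ereal) \<Rightarrow> ereal \<Rightarrow> real" where
  "delay_cdf M X x = measure (delay_law M X) {..x}"

text \<open>
  The infimum is taken in the extended reals: a level that is not reached at any finite \<open>x\<close> has
  quantile \<open>\<infinity>\<close> (no limit on the caching time). For levels above \<open>P(0) = P(-\<infinity>)\<close> it agrees with the
  infimum over real \<open>x\<close>, where the infimum of the empty set is \<open>\<infinity>\<close>.
\<close>

definition delay_quantile :: "'a measure \<Rightarrow> ('a \<Rightarrow> ereal) \<Rightarrow> real \<Rightarrow> ereal" where
  "delay_quantile M X z = Inf {x. delay_cdf M X x \<ge> z}"

definition throughput :: "real \<Rightarrow> real \<Rightarrow> 'a measure \<Rightarrow> ('a \<Rightarrow> ereal) \<Rightarrow> ereal \<Rightarrow> real" where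
  "throughput lam B M X t = lam * B * measure (delay_law M X) {0<..t}"

text \<open>
  The storage cost is extended-valued because it can be infinite at \<open>t = \<infinity>\<close>. The convention
  \<open>\<infinity> * 0 = 0\<close> gives the correct value there: if every file is eventually requested, the cost is
  \<open>lam * B\<close> times the mean delay.
\<close>

definition storage :: "real \<Rightarrow> real \<Rightarrow> 'a measure \<Rightarrow> ('a \<Rightarrow> ereal) \<Rightarrow> ereal \<Rightarrow> ennreal" where
  "storage lam B M X t = ennreal (lam * B) *
     ((\<integral>\<^sup>+x\<in>{0<..t}. e2ennreal x \<partial>delay_law M X)
      + e2ennreal t * (ennreal (delay_cdf M X 0) + emeasure (delay_law M X) {t<..}))"

definition storage_of_throughput ::
    "real \<Rightarrow> real \<Rightarrow> 'a measure \<Rightarrow> ('a \<Rightarrow> ereal) \<Rightarrow> real \<Rightarrow> ennreal" where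
  "storage_of_throughput lam B M X R =
     storage lam B M X (delay_quantile M X (R / (lam * B) + delay_cdf M X 0))"

text \<open>
  If \<open>P\<close> jumps, the normalized throughputs strictly inside a jump are not produced by any
  maximum caching time.
\<close>

definition attained_throughputs ::
    "real \<Rightarrow> real \<Rightarrow> 'a measure \<Rightarrow> ('a \<Rightarrow> ereal) \<Rightarrow> real set" where
  "attained_throughputs lam B M X = {R. R > 0 \<and> (\<exists>t>0. R = throughput lam B M X t)}"

end

theory Submission
  imports Defs
begin

text \<open>
  Up to the factor \<open>lam * B\<close>, the storage cost is the expected caching time: \<open>min X t\<close> for a file
  that is requested and \<open>t\<close> for one that is not. It is therefore monotone in \<open>t\<close>, and strictly
  so from \<open>t1\<close> to \<open>t2\<close> as soon as some request delay falls into \<open>{t1<..t2}\<close> with positive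
  probability, that is, as soon as the throughput grows. Right continuity of \<open>P\<close> makes the quantile
  of an attained level attain that level again, so the throughput determines the caching time up to
  changes that matter neither for the throughput nor for the cost.
\<close>

section \<open>Probability laws on the extended reals and their Stieltjes measure\<close>

locale extended_distribution = prob_space N for N :: "ereal measure" +
  assumes sets_N [simp, measurable_cong]: "sets N = sets borel"
begin

lemma space_N [simp]: "space N = UNIV"
  using sets_N[THEN sets_eq_imp_space_eq] by simp

text \<open>The finite part of the law, moved to the real line. The mass at
  \<open>-\<infinity>\<close> and \<open>\<infinity>\<close> is dropped, so this is in general only
  a finite measure; it turns out to be the measure \<open>dP\<close> of the theorem.\<close>

definition real_part :: "real measure" where
  "real_part = distr (density N (indicator (range ereal))) borel real_of_ereal"

lemma range_ereal_borel [measurable]: "range ereal \<in> sets borel"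
proof -
  have "range ereal = UNIV - {\<infinity>, -\<infinity>}"
  proof (rule set_eqI)
    show "x \<in> range ereal \<longleftrightarrow> x \<in> UNIV - {\<infinity>, -\<infinity>}" for x
      by (cases x) auto
  qed
  then show ?thesis by simp
qed

lemma emeasure_real_part:
  assumes [measurable]: "A \<in> sets borel"
  shows "emeasure real_part A = emeasure N (real_of_ereal -` A \<inter> range ereal)"
proof -
  have [measurable]: "real_of_ereal -` A \<in> sets borel"
    by (rule measurable_sets_borel[of real_of_ereal borel]) auto
  show ?thesis
    unfolding real_part_def
    by (subst emeasure_distr)
       (simp_all add: emeasure_density indicator_inter_arith[symmetric] Int_commute)
qed

sublocale real_part: finite_borel_measure real_part
proof (intro finite_borel_measure.intro finite_measureI finite_borel_measure_axioms.intro)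
  show "emeasure real_part (space real_part) \<noteq> \<infinity>"
    using emeasure_real_part[of UNIV] by (simp add: real_part_def)
qed (simp add: real_part_def)

lemma measure_real_part:
  "A \<in> sets borel \<Longrightarrow> measure real_part A = measure N (real_of_ereal -` A \<inter> range ereal)"
  by (simp add: measure_def emeasure_real_part)

lemma measure_real_part_singleton: "measure real_part {x} = measure N {ereal x}"
proof -
  have "real_of_ereal -` {x} \<inter> range ereal = {ereal x}"
  proof (rule set_eqI)
    show "y \<in> real_of_ereal -` {x} \<inter> range ereal \<longleftrightarrow> y \<in> {ereal x}" for y
      by (cases y) auto
  qed
  then show ?thesis by (simp add: measure_real_part)
qed

lemma cdf_real_part: "cdf real_part x = measure N {..ereal x} - measure N {-\<infinity>}"
proof -
  have *: "{..ereal x} - {-\<infinity>} = real_of_ereal -` {..x} \<inter> range ereal"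
  proof (rule set_eqI)
    show "y \<in> {..ereal x} - {-\<infinity>} \<longleftrightarrow> y \<in> real_of_ereal -` {..x} \<inter> range ereal" for y
      by (cases y) auto
  qed
  have "measure N ({..ereal x} - {-\<infinity>}) = measure N {..ereal x} - measure N {-\<infinity>}"
    by (rule finite_measure_Diff) auto
  then show ?thesis
    by (simp add: cdf_def measure_real_part *)
qed

text \<open>\<open>interval_measure\<close> depends only on increments, so the constant by which the
  distribution function exceeds \<open>cdf real_part\<close>, the mass at
  \<open>-\<infinity>\<close>, cancels. The two measures agree on half-open intervals, which form an
  intersection-stable generator of the Borel sets.\<close>

lemma interval_measure_eq_real_part:
  "interval_measure (\<lambda>x. measure N {..ereal x}) = real_part"
proof -
  define F where "F x = measure N {..ereal x}" for x
  have F: "F = (\<lambda>x. cdf real_part x + measure N {-\<infinity>})"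
    by (simp add: F_def cdf_real_part fun_eq_iff)
  have mono: "F x \<le> F y" if "x \<le> y" for x y
    using real_part.cdf_nondecreasing[OF that] by (simp add: F)
  have rc: "continuous (at_right a) F" for a
    unfolding F by (intro continuous_intros real_part.cdf_is_right_cont)
  have "interval_measure F = real_part"
  proof (rule measure_eqI_generator_eq[where \<Omega>=UNIV])
    fix A assume "A \<in> range (\<lambda>(a, b). {a<..b::real})"
    then obtain a b where A: "A = {a<..b}" by auto
    show "emeasure (interval_measure F) A = emeasure real_part A"
    proof (cases "a \<le> b")
      case True
      then show ?thesis
        unfolding A real_part.emeasure_Ioc[OF True]
        using emeasure_interval_measure_Ioc[of a b F, OF True mono rc] by (simp add: F_def cdf_real_part)
    qed (simp add: A)
  next
    show "(\<Union>i. {- real (i::nat)<..real i}) = UNIV"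
      by (rule UN_Ioc_eq_UNIV)
  qed (auto simp: emeasure_interval_measure_Ioc[OF _ mono rc] borel_sigma_sets_Ioc
        Int_stable_def real_part_def)
  then show ?thesis unfolding F_def .
qed

text \<open>Links the Stieltjes integral of the theorem with the integral against the law in
  \<open>storage\<close>. For \<open>t = \<infinity>\<close> the set \<open>{0<..t}\<close> contains
  the point \<open>\<infinity>\<close>, which \<open>real_part\<close> does not see;
  \<open>fin\<close> makes it a null set.\<close>

lemma nn_integral_interval_measure:
  assumes fin: "AE x in N. x \<noteq> \<infinity>"
  shows "(\<integral>\<^sup>+x\<in>{x. 0 < x \<and> ereal x \<le> t}. ennreal x
            \<partial>interval_measure (\<lambda>x. measure N {..ereal x})) = (\<integral>\<^sup>+x\<in>{0<..t}. e2ennreal x \<partial>N)"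
proof -
  have "(\<integral>\<^sup>+x\<in>{x. 0 < x \<and> ereal x \<le> t}. ennreal x
            \<partial>interval_measure (\<lambda>x. measure N {..ereal x}))
      = (\<integral>\<^sup>+x. indicator (range ereal) x *
          (ennreal (real_of_ereal x) *
            indicator {x. 0 < x \<and> ereal x \<le> t} (real_of_ereal x)) \<partial>N)"
    unfolding interval_measure_eq_real_part real_part_def
    by (subst nn_integral_distr, measurable, subst nn_integral_density) (auto)
  also have "\<dots> = (\<integral>\<^sup>+x\<in>{0<..t}. e2ennreal x \<partial>N)"
  proof (rule nn_integral_cong_AE)
    show "AE x in N. indicator (range ereal) x *
          (ennreal (real_of_ereal x) * indicator {x. 0 < x \<and> ereal x \<le> t} (real_of_ereal x))
        = e2ennreal x * indicator {0<..t} x"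
      using fin
    proof eventually_elim
      case (elim x)
      then show ?case by (cases x) (auto simp: indicator_def)
    qed
  qed
  finally show ?thesis .
qed

lemma measure_singleton_eq_0:
  assumes "continuous_on UNIV (\<lambda>x. measure N {..ereal x})"
  shows "measure N {ereal x} = 0"
proof -
  have "continuous_on UNIV (\<lambda>x. measure N {..ereal x} - measure N {-\<infinity>})"
    by (intro continuous_intros assms)
  then have "continuous_on UNIV (cdf real_part)"
    by (simp add: cdf_real_part[abs_def])
  then have "isCont (cdf real_part) x"
    by (simp add: continuous_on_eq_continuous_at)
  then show ?thesis
    by (simp add: real_part.isCont_cdf measure_real_part_singleton)
qed

text \<open>Continuity from above along a decreasing sequence in \<open>A\<close> that converges to
  \<open>Inf A\<close>. It serves to show that the infimum in the quantile is attained.\<close>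

lemma le_measure_atMost_Inf:
  assumes "A \<noteq> {}" and "\<And>x. x \<in> A \<Longrightarrow> z \<le> measure N {..x}"
  shows "z \<le> measure N {..Inf A}"
proof -
  obtain f :: "nat \<Rightarrow> ereal" where f: "decseq f" "range f \<subseteq> A" "Inf A = (INF i. f i)"
    using Inf_countable_INF[OF assms(1)] by auto
  have "(\<lambda>i. measure N {..f i}) \<longlonglongrightarrow> measure N (\<Inter>i. {..f i})"
    using f(1) by (intro finite_Lim_measure_decseq) (auto simp: decseq_def intro: order_trans)
  moreover have "(\<Inter>i. {..f i}) = {..Inf A}"
    by (auto simp: f(3) le_INF_iff)
  ultimately have "(\<lambda>i. measure N {..f i}) \<longlonglongrightarrow> measure N {..Inf A}"
    by simp
  then show ?thesis
    by (rule LIMSEQ_le_const) (use f(2) assms(2) in auto)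
qed

text \<open>Continuity from below. The point \<open>u\<close> keeps \<open>{..<t}\<close> nonempty,
  so that \<open>t\<close> is the supremum of an increasing sequence of smaller points.\<close>

lemma measure_lessThan_le:
  assumes "u < t" and "\<And>x. x < t \<Longrightarrow> measure N {..x} \<le> z"
  shows "measure N {..<t} \<le> z"
proof -
  obtain f :: "nat \<Rightarrow> ereal" where f: "incseq f" "range f \<subseteq> {..<t}" "(SUP i. f i) = t"
    using Sup_countable_SUP[of "{..<t}"] assms(1) by auto
  have "(\<lambda>i. measure N {..f i}) \<longlonglongrightarrow> measure N (\<Union>i. {..f i})"
    using f(1) by (intro finite_Lim_measure_incseq) (auto simp: incseq_def intro: order_trans)
  moreover have "(\<Union>i. {..f i}) = {..<t}"
  proof (rule antisym[OF _ subsetI])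
    show "(\<Union>i. {..f i}) \<subseteq> {..<t}"
      using f(2) by (auto intro: le_less_trans)
    show "x \<in> (\<Union>i. {..f i})" if "x \<in> {..<t}" for x
      using that less_SUP_iff[of x f UNIV] by (auto simp: f(3) intro: less_imp_le)
  qed
  ultimately have "(\<lambda>i. measure N {..f i}) \<longlonglongrightarrow> measure N {..<t}"
    by simp
  then show ?thesis
    by (rule LIMSEQ_le_const2) (use f(2) assms(2) in auto)
qed

end

section \<open>Distribution function and quantile of the request delay\<close>

locale static_caching =
  fixes M :: "'a measure" and X :: "'a \<Rightarrow> ereal" and lam B :: real
  assumes prob_space_M: "prob_space M"
    and X_measurable [measurable]: "X \<in> borel_measurable M"
    and X_finite: "AE \<omega> in M. X \<omega> \<noteq> \<infinity>"
    and lam_pos: "lam > 0" and B_pos: "B > 0"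
begin

abbreviation N where "N \<equiv> delay_law M X"
abbreviation P where "P \<equiv> delay_cdf M X"
abbreviation q where "q \<equiv> P 0"
abbreviation Pinv where "Pinv \<equiv> delay_quantile M X"

sublocale law: extended_distribution N
proof -
  interpret prob_space N
    unfolding delay_law_def by (rule prob_space.prob_space_distr[OF prob_space_M]) measurable
  show "extended_distribution N"
    by unfold_locales (simp add: delay_law_def)
qed

lemma lamB_pos: "lam * B > 0"
  using lam_pos B_pos by simp

lemma P_eq: "P t = measure N {..t}"
  by (simp add: delay_cdf_def)

lemma P_mono: "s \<le> t \<Longrightarrow> P s \<le> P t"
  unfolding P_eq by (rule law.finite_measure_mono) auto

lemma P_le_1: "P t \<le> 1"
  unfolding P_eq by (rule law.prob_le_1)

lemma P_nonneg: "0 \<le> P t"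
  unfolding P_eq by simp

lemma P_top: "P \<infinity> = 1"
  using law.prob_space by (simp add: P_eq atMost_def)

lemma measure_Ioc: "s \<le> t \<Longrightarrow> measure N {s<..t} = P t - P s"
  unfolding P_eq
  by (subst law.finite_measure_Diff[symmetric]) (auto intro!: arg_cong[where f="measure N"])

lemma emeasure_Ioi: "emeasure N {t<..} = ennreal (1 - P t)"
proof -
  have "{t<..} = space N - {..t}" by auto
  then show ?thesis
    by (simp add: law.emeasure_eq_measure P_eq law.prob_compl del: law.space_N)
qed

lemma AE_finite: "AE x in N. x \<noteq> \<infinity>"
  unfolding delay_law_def by (subst AE_distr_iff) (use X_finite in auto)

lemma measure_infinity: "measure N {\<infinity>} = 0"
  using AE_finite by (subst law.prob_eq_0) auto

lemma throughput_eq: "0 \<le> t \<Longrightarrow> throughput lam B M X t = lam * B * (P t - q)"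
  by (simp add: throughput_def measure_Ioc)

text \<open>Since \<open>P \<infinity> = 1\<close>, the bound on \<open>z\<close> puts
  \<open>\<infinity>\<close> into the set whose infimum is taken, so this set is nonempty.\<close>

lemma le_P_Pinv: "z \<le> 1 \<Longrightarrow> z \<le> P (Pinv z)"
  unfolding delay_quantile_def P_eq
  by (rule law.le_measure_atMost_Inf) (use P_top in \<open>auto simp: P_eq intro!: exI[of _ \<infinity>]\<close>)

lemma Pinv_le: "z \<le> P t \<Longrightarrow> Pinv z \<le> t"
  unfolding delay_quantile_def by (rule Inf_lower) simp

lemma P_less: "x < Pinv z \<Longrightarrow> P x < z"
  using Pinv_le[of z x] by (meson leD le_less_linear)

lemma Pinv_mono: "z \<le> z' \<Longrightarrow> Pinv z \<le> Pinv z'"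
  unfolding delay_quantile_def by (rule Inf_superset_mono) auto

text \<open>\<open>Pinv (P t)\<close> is the leftmost point at which the level \<open>P t\<close> is
  reached, and \<open>P\<close> is constant from there up to \<open>t\<close>. Jumps do no harm
  because the level is a value of \<open>P\<close>.\<close>

lemma P_Pinv_P: "P (Pinv (P t)) = P t"
  using le_P_Pinv[OF P_le_1] P_mono[OF Pinv_le[OF order_refl]] by (rule antisym[rotated])

lemma Pinv_pos: "q < z \<Longrightarrow> z \<le> 1 \<Longrightarrow> 0 < Pinv z"
  using le_P_Pinv[of z] P_mono[of "Pinv z" 0] by (meson leD le_less_linear order_less_le_trans)

text \<open>To the left of the quantile \<open>P\<close> stays below \<open>z\<close>, so the open
  half-line up to it has mass at most \<open>z\<close>; without an atom at the quantile itself,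
  \<open>P\<close> cannot exceed \<open>z\<close> there.\<close>

lemma P_Pinv:
  assumes "continuous_on UNIV (\<lambda>x. P (ereal x))" "q < z" "z \<le> 1"
  shows "P (Pinv z) = z"
proof (rule antisym[OF _ le_P_Pinv[OF assms(3)]])
  let ?t = "Pinv z"
  have t: "0 < ?t"
    using Pinv_pos assms(2,3) .
  \<comment> \<open>Positivity excludes \<open>-\<infinity>\<close>; continuity excludes an atom at
    a real point, and almost sure finiteness of \<open>X\<close> one at
    \<open>\<infinity>\<close>.\<close>
  have "measure N {?t} = 0"
    using t law.measure_singleton_eq_0 assms(1) measure_infinity
    by (cases ?t) (auto simp: P_eq)
  moreover have "measure N {..<?t} \<le> z"
    using t by (rule law.measure_lessThan_le) (auto simp: P_eq[symmetric] intro: less_imp_le P_less)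
  moreover have "P ?t = measure N {..<?t} + measure N {?t}"
    unfolding P_eq ivl_disj_un(2)[symmetric]
    by (rule law.finite_measure_Union) auto
  ultimately show "P ?t \<le> z" by simp
qed

section \<open>Storage cost as an expected caching time, and its monotonicity\<close>

definition caching_time :: "ereal \<Rightarrow> ereal \<Rightarrow> ennreal" where
  "caching_time t x = e2ennreal (if x \<le> 0 then t else min x t)"

lemma caching_time_measurable [measurable]: "caching_time t \<in> borel_measurable borel"
  unfolding caching_time_def[abs_def] by measurable

text \<open>For \<open>0 \<le> t\<close> the sets \<open>{..0}\<close>, \<open>{0<..t}\<close> and
  \<open>{t<..}\<close> partition the delays, and the three terms of \<open>storage\<close> are the
  contributions of these sets. Delays \<open>x \<le> 0\<close> count as never requested, in
  accordance with \<open>q = P 0\<close>. A single integrand reduces monotonicity in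
  \<open>t\<close> to a pointwise comparison.\<close>

lemma storage_eq:
  assumes "0 \<le> t"
  shows "storage lam B M X t = ennreal (lam * B) * (\<integral>\<^sup>+x. caching_time t x \<partial>N)"
proof -
  have "(\<integral>\<^sup>+x. caching_time t x \<partial>N) =
      (\<integral>\<^sup>+x. e2ennreal x * indicator {0<..t} x
           + (e2ennreal t * indicator {..0} x + e2ennreal t * indicator {t<..} x) \<partial>N)"
    using assms by (intro nn_integral_cong) (auto simp: caching_time_def indicator_def min_def)
  also have "\<dots> = (\<integral>\<^sup>+x\<in>{0<..t}. e2ennreal x \<partial>N)
      + e2ennreal t * (ennreal q + emeasure N {t<..})"
    by (simp add: nn_integral_add nn_integral_cmult_indicator distrib_left
          law.emeasure_eq_measure P_eq)
  finally show ?thesis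
    unfolding storage_def by simp
qed

lemma caching_time_mono: "s \<le> t \<Longrightarrow> caching_time s x \<le> caching_time t x"
  unfolding caching_time_def by (intro e2ennreal_mono) (auto simp: min_def)

lemma storage_mono:
  assumes "0 \<le> s" "s \<le> t"
  shows "storage lam B M X s \<le> storage lam B M X t"
  using assms by (auto simp: storage_eq intro!: mult_left_mono nn_integral_mono caching_time_mono)

text \<open>The caching times differ on \<open>{s<..t}\<close>, which has mass
  \<open>P t - P s > 0\<close>. A strict inequality of integrals follows once the smaller one is
  finite; the larger one may be infinite.\<close>

lemma storage_strict_mono:
  assumes "0 \<le> s" "P s < P t"
  shows "storage lam B M X s < storage lam B M X t"
proof -
  have "s < t"
    using assms(2) P_mono[of t s] by (meson leD le_less_linear)
  \<comment> \<open>A real \<open>s\<close> bounds the smaller caching time, which makes its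
    integral finite under a probability measure.\<close>
  have "s \<noteq> \<infinity>" using \<open>s < t\<close> by auto
  then obtain r where r: "s = ereal r" "0 \<le> r"
    using assms(1) by (cases s) auto
  have "(\<integral>\<^sup>+x. caching_time s x \<partial>N) < (\<integral>\<^sup>+x. caching_time t x \<partial>N)"
  proof (rule nn_integral_less)
    have "(\<integral>\<^sup>+x. caching_time s x \<partial>N) \<le> (\<integral>\<^sup>+x. ennreal r \<partial>N)"
      unfolding e2ennreal_ereal[symmetric] r
      by (intro nn_integral_mono) (auto simp: caching_time_def intro!: e2ennreal_mono simp del: e2ennreal_ereal)
    also have "\<dots> < \<infinity>"
      using law.emeasure_space_1 by simp
    finally show "(\<integral>\<^sup>+x. caching_time s x \<partial>N) \<noteq> \<infinity>" by simp
    show "AE x in N. caching_time s x \<le> caching_time t x"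
      using \<open>s < t\<close> by (intro AE_I2 caching_time_mono) simp
    show "\<not> (AE x in N. caching_time t x \<le> caching_time s x)"
    proof
      assume "AE x in N. caching_time t x \<le> caching_time s x"
      then have "AE x in N. x \<notin> {s<..t}"
      proof eventually_elim
        case (elim x)
        show ?case
        proof
          assume "x \<in> {s<..t}"
          then have x: "s < x" "x \<le> t" by auto
          with assms(1) have "caching_time t x = e2ennreal x" "caching_time s x = e2ennreal s"
            by (auto simp: caching_time_def)
          \<comment> \<open>\<open>e2ennreal\<close> truncates at 0, but \<open>x\<close> and
            \<open>s\<close> are nonnegative, so going back to \<open>ereal\<close> recovers them
            and contradicts \<open>s < x\<close>.\<close>
          with elim have "enn2ereal (e2ennreal x) \<le> enn2ereal (e2ennreal s)"
            by (simp add: less_eq_ennreal.rep_eq)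
          then show False
            using x assms(1) by (simp add: enn2ereal_e2ennreal)
        qed
      qed
      then have "measure N {s<..t} = 0"
        by (subst law.prob_eq_0) auto
      then show False
        using measure_Ioc[of s t] \<open>s < t\<close> assms(2) by simp
    qed
  qed auto
  then show ?thesis
    using assms(1) \<open>s < t\<close> lamB_pos by (simp add: storage_eq ennreal_mult_strict_left_mono)
qed

section \<open>Storage cost as a function of the throughput\<close>

lemma attained_throughputsE:
  assumes "R \<in> attained_throughputs lam B M X"
  obtains t where "0 < t" "R = lam * B * (P t - q)" "R / (lam * B) + q = P t" "q < P t"
proof -
  from assms obtain t where t: "0 < t" "R = lam * B * (P t - q)" "0 < R"
    by (auto simp: attained_throughputs_def throughput_eq)
  then have "R / (lam * B) = P t - q" "0 < P t - q"
    using lam_pos B_pos by (auto simp: zero_less_mult_iff mult_less_0_iff)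
  then have "R / (lam * B) + q = P t" "q < P t" by simp_all
  with t that show ?thesis by blast
qed

lemma attained_throughputs_subset:
  "attained_throughputs lam B M X \<subseteq> {0<..lam * B * (1 - q)}"
  using lamB_pos P_le_1
  by (auto simp: attained_throughputs_def throughput_eq simp del: mult_pos_pos intro!: mult_left_mono)

lemma throughput_Pinv:
  assumes "R \<in> attained_throughputs lam B M X"
  shows "throughput lam B M X (Pinv (R / (lam * B) + q)) = R"
proof -
  from assms obtain t
    where t: "R = lam * B * (P t - q)" "R / (lam * B) + q = P t" "q < P t"
    by (rule attained_throughputsE)
  have "0 < Pinv (P t)"
    using Pinv_pos[OF t(3) P_le_1] .
  then show ?thesis
    by (simp add: t(2) throughput_eq P_Pinv_P) (simp add: t(1))
qed

text \<open>An attained level is a value of \<open>P\<close>, so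
  \<open>P T = R / (lam * B) + q\<close>. In the factor \<open>q + (1 - P T)\<close> of the caching
  time, \<open>q\<close> then cancels.\<close>

lemma storage_of_throughput_eq:
  assumes "R \<in> attained_throughputs lam B M X"
  defines "T \<equiv> Pinv (R / (lam * B) + q)"
  shows "storage_of_throughput lam B M X R = ennreal (lam * B) *
      ((\<integral>\<^sup>+x\<in>{x. 0 < x \<and> ereal x \<le> T}. ennreal x \<partial>interval_measure (\<lambda>x. P (ereal x)))
       + ennreal (1 - R / (lam * B)) * e2ennreal T)"
proof -
  from assms(1) obtain t where t: "R / (lam * B) + q = P t"
    by (rule attained_throughputsE)
  have "ennreal q + emeasure N {T<..} = ennreal (q + (1 - P T))"
    unfolding emeasure_Ioi using P_nonneg P_le_1 by (simp add: ennreal_plus)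
  also have "q + (1 - P T) = 1 - R / (lam * B)"
    using t by (simp add: T_def P_Pinv_P)
  finally show ?thesis
    using law.nn_integral_interval_measure[OF AE_finite, of T]
    unfolding storage_of_throughput_def storage_def T_def[symmetric]
    unfolding P_eq
    by (simp only: mult.commute)
qed

text \<open>At the two quantiles \<open>P\<close> takes exactly the two attained levels, so
  \<open>storage_strict_mono\<close> applies to these quantiles.\<close>

lemma storage_of_throughput_strict_mono:
  "strict_mono_on (attained_throughputs lam B M X) (storage_of_throughput lam B M X)"
proof (rule strict_mono_onI)
  fix R R' assume R: "R \<in> attained_throughputs lam B M X" "R' \<in> attained_throughputs lam B M X" "R < R'"
  obtain t where t: "R / (lam * B) + q = P t" "q < P t"
    using R(1) by (rule attained_throughputsE)
  obtain t' where t': "R' / (lam * B) + q = P t'"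
    using R(2) by (rule attained_throughputsE)
  have "P t < P t'"
    unfolding t(1)[symmetric] t'[symmetric] using R(3) lamB_pos by (simp add: divide_strict_right_mono)
  then show "storage_of_throughput lam B M X R < storage_of_throughput lam B M X R'"
    unfolding storage_of_throughput_def t t'
    by (intro storage_strict_mono less_imp_le[OF Pinv_pos]) (auto simp: P_Pinv_P P_le_1 t)
qed

lemma level_bounds:
  assumes "R \<in> {0<..lam * B * (1 - q)}"
  shows "q < R / (lam * B) + q" "R / (lam * B) + q \<le> 1"
  using assms lamB_pos lam_pos B_pos by (auto simp: field_simps)

text \<open>Levels inside one jump of \<open>P\<close> share their quantile and hence their cost, so
  on the full range only weak monotonicity is claimed.\<close>

lemma storage_of_throughput_mono:
  "mono_on {0<..lam * B * (1 - q)} (storage_of_throughput lam B M X)"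
proof (rule mono_onI)
  fix R R' assume R: "R \<in> {0<..lam * B * (1 - q)}" "R' \<in> {0<..lam * B * (1 - q)}" "R \<le> R'"
  show "storage_of_throughput lam B M X R \<le> storage_of_throughput lam B M X R'"
    unfolding storage_of_throughput_def
    using R(3) lamB_pos
    by (intro storage_mono less_imp_le[OF Pinv_pos] Pinv_mono level_bounds[OF R(1)])
       (simp add: divide_right_mono)
qed

lemma attained_throughputs_eq:
  assumes "continuous_on UNIV (\<lambda>x. P (ereal x))"
  shows "attained_throughputs lam B M X = {0<..lam * B * (1 - q)}"
proof (rule antisym[OF attained_throughputs_subset subsetI])
  fix R assume R: "R \<in> {0<..lam * B * (1 - q)}"
  \<comment> \<open>The quantile itself is the caching time that produces \<open>R\<close>, by
    \<open>P_Pinv\<close>.\<close>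
  let ?t = "Pinv (R / (lam * B) + q)"
  have t: "0 < ?t"
    using Pinv_pos[OF level_bounds[OF R]] .
  have "throughput lam B M X ?t = R"
    using t P_Pinv[OF assms level_bounds[OF R]] lam_pos B_pos by (simp add: throughput_eq)
  with t R show "R \<in> attained_throughputs lam B M X"
    unfolding attained_throughputs_def by fastforce
qed

text \<open>By \<open>P_Pinv\<close> the quantile is a preimage of \<open>z\<close>, and injectivity
  makes it the only one. The end levels \<open>q\<close> and 1 are left out because \<open>P\<close>
  may take them on whole half-lines.\<close>

lemma Pinv_eq_the_inv_into:
  assumes "continuous_on UNIV (\<lambda>x. P (ereal x))"
    and "inj_on P {x. q < P x \<and> P x < 1}" and "q < z" "z < 1"
  shows "Pinv z = the_inv_into {x. q < P x \<and> P x < 1} P z"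
  using assms P_Pinv[OF assms(1,3)] by (intro the_inv_into_f_eq[symmetric]) auto

end

theorem theorem1:
  fixes M :: "'a measure" and X :: "'a \<Rightarrow> ereal" and lam B q :: real
    and P :: "ereal \<Rightarrow> real" and Pinv :: "real \<Rightarrow> ereal" and S :: "real \<Rightarrow> ennreal"
  assumes "prob_space M"
    and "X \<in> borel_measurable M"
    and "AE \<omega> in M. X \<omega> \<noteq> \<infinity>"
    and "lam > 0" and "B > 0"
  defines "P \<equiv> delay_cdf M X"
    and "q \<equiv> P 0"
    and "Pinv \<equiv> delay_quantile M X"
    and "S \<equiv> storage_of_throughput lam B M X"
  assumes "q = measure M {\<omega> \<in> space M. X \<omega> = -\<infinity>}"
  shows "attained_throughputs lam B M X \<subseteq> {0<..lam * B * (1 - q)} \<and>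
         (\<forall>R\<in>attained_throughputs lam B M X.
           throughput lam B M X (Pinv (R / (lam * B) + q)) = R \<and>
           S R = ennreal (lam * B) *
             ((\<integral>\<^sup>+x\<in>{x. 0 < x \<and> ereal x \<le> Pinv (R / (lam * B) + q)}.
                 ennreal x \<partial>interval_measure (\<lambda>x. P (ereal x)))
              + ennreal (1 - R / (lam * B)) * e2ennreal (Pinv (R / (lam * B) + q)))) \<and>
         strict_mono_on (attained_throughputs lam B M X) S \<and>
         mono_on {0<..lam * B * (1 - q)} S \<and>
         (continuous_on UNIV (\<lambda>x::real. P (ereal x)) \<longrightarrow>
           attained_throughputs lam B M X = {0<..lam * B * (1 - q)} \<and>
           (\<forall>z\<in>{q<..1}. P (Pinv z) = z) \<and>
           (inj_on P {x. q < P x \<and> P x < 1} \<longrightarrow>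
             (\<forall>z\<in>{q<..<1}. Pinv z = the_inv_into {x. q < P x \<and> P x < 1} P z)))"
proof -
  interpret static_caching M X lam B
    by (rule static_caching.intro) (fact assms)+
  show ?thesis
    \<comment> \<open>These are the defining equations of \<open>P\<close>, \<open>q\<close>,
      \<open>Pinv\<close> and \<open>S\<close>; unfolding them yields the terms abbreviated in the
      locale.\<close>
    unfolding assms(6-9)
    by (intro conjI ballI impI attained_throughputs_subset throughput_Pinv storage_of_throughput_eq
        storage_of_throughput_strict_mono storage_of_throughput_mono attained_throughputs_eq
        P_Pinv Pinv_eq_the_inv_into) simp_all
qed

end
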